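(* The TRS $\mathcal{H}_{\mathrm{lab}}\cup\mathcal{D}\mathrm{ec}$ is AC terminating.
   Context: Let $\mathbb{O}$ be the set of ordinals below $\varepsilon_0$. The signature consists of constants $\mathsf{h},\mathsf{0}$; unary $\mathsf{I},\mathsf{E},\mathsf{s}$; binary $\mathsf{C},\mathsf{D}$; binary $\mathsf{A}_v,\mathsf{B}_v$ for each $v\in\mathbb{O}$; and the binary symbol $\mid$ (infix), the only AC symbol. The TRS $\mathcal{H}_{\mathrm{lab}}$ consists of, for all $v\in\mathbb{O}$: (1) $\mathsf{A}_\omega(n,\mathsf{I}(\mathsf{h}))\to\mathsf{A}_1(\mathsf{s}(n),\mathsf{h})$; (2) $\mathsf{A}_{\omega^{v+1}}(n,\mathsf{I}(\mathsf{h}\mid x))\to\mathsf{A}_{\omega^v}(\mathsf{s}(n),\mathsf{I}(x))$; (3) $\mathsf{A}_{\omega^v}(n,\mathsf{I}(x))\to\mathsf{B}_{\omega^v}(n,\mathsf{D}(\mathsf{s}(n),\mathsf{I}(x)))$; (4) $\mathsf{C}(\mathsf{0},x)\to\mathsf{E}(x)$; (5) $\mathsf{C}(\mathsf{s}(n),x)\to x\mid\mathsf{C}(n,x)$; (6) $\mathsf{I}(\mathsf{E}(x)\mid y)\to\mathsf{E}(\mathsf{I}(x\mid y))$; (7) $\mathsf{I}(\mathsf{E}(x))\to\mathsf{E}(\mathsf{I}(x))$; (8) $\mathsf{D}(n,\mathsf{I}(\mathsf{I}(x)))\to\mathsf{I}(\mathsf{D}(n,\mathsf{I}(x)))$; (9)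 $\mathsf{D}(n,\mathsf{I}(\mathsf{I}(x)\mid y))\to\mathsf{I}(\mathsf{D}(n,\mathsf{I}(x))\mid y)$; (10) $\mathsf{D}(n,\mathsf{I}(\mathsf{I}(\mathsf{h}\mid x)\mid y))\to\mathsf{I}(\mathsf{C}(n,\mathsf{I}(x))\mid y)$; (11) $\mathsf{D}(n,\mathsf{I}(\mathsf{I}(\mathsf{h}\mid x)))\to\mathsf{I}(\mathsf{C}(n,\mathsf{I}(x)))$; (12) $\mathsf{D}(n,\mathsf{I}(\mathsf{I}(\mathsf{h})\mid y))\to\mathsf{I}(\mathsf{C}(n,\mathsf{h})\mid y)$; (13) $\mathsf{D}(n,\mathsf{I}(\mathsf{I}(\mathsf{h})))\to\mathsf{I}(\mathsf{C}(n,\mathsf{h}))$; (14) $\mathsf{B}_{v+1}(n,\mathsf{E}(x))\to\mathsf{A}_v(\mathsf{s}(n),x)$. $\mathcal{D}\mathrm{ec}$ consists of $\mathsf{A}_v(n,x)\to\mathsf{A}_w(n,x)$ and $\mathsf{B}_v(n,x)\to\mathsf{B}_w(n,x)$ for all $v,w\in\mathbb{O}$ with $v>w$. $=_{\mathrm{AC}}$ is the congruence generated by associativity and commutativity of $\mid$; for a TRS $\mathcal{R}$, $\to_{\mathcal{R}/\mathrm{AC}}={=_{\mathrm{AC}}}\cdot{\to_{\mathcal{R}}}\cdot{=_{\mathrm{AC}}}$ with $\to_{\mathcal{R}}$ the closure of $\mathcal{R}$ under substitutions and contexts, and $\mathcal{R}$ is AC terminating if $\to_{\mathcal{R}/\mathrm{AC}}$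 is well-founded. *)

theory Defs
  imports Main
begin

text \<open>
  Ordinals below epsilon_0 are represented by their Cantor normal forms:
  \<open>CNil\<close> is 0 and \<open>CAdd a b\<close> is $\omega^a + b$. The predicate \<open>nf\<close> requires the exponents to be
  weakly decreasing, hereditarily; on such forms \<open>cless\<close> is the order of the ordinals denoted.
\<close>

datatype cnf = CNil | CAdd cnf cnf

fun cless :: "cnf \<Rightarrow> cnf \<Rightarrow> bool" where
  "cless _ CNil \<longleftrightarrow> False"
| "cless CNil (CAdd _ _) \<longleftrightarrow> True"
| "cless (CAdd a b) (CAdd c d) \<longleftrightarrow> cless a c \<or> a = c \<and> cless b d"

fun nf :: "cnf \<Rightarrow> bool" where
  "nf CNil \<longleftrightarrow> True"
| "nf (CAdd a CNil) \<longleftrightarrow> nf a"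
| "nf (CAdd a (CAdd b c)) \<longleftrightarrow> nf a \<and> (b = a \<or> cless b a) \<and> nf (CAdd b c)"

fun csuc :: "cnf \<Rightarrow> cnf" where
  "csuc CNil = CAdd CNil CNil"
| "csuc (CAdd a b) = CAdd a (csuc b)"

lemma cless_irrefl: "\<not> cless a a"
  by (induction a) auto

lemma cless_CNil_left: "cless CNil a \<longleftrightarrow> a \<noteq> CNil"
  by (cases a) auto

lemma cless_trans: "cless a b \<Longrightarrow> cless b c \<Longrightarrow> cless a c"
proof (induction b arbitrary: a c)
  case CNil
  then show ?case by simp
next
  case (CAdd b1 b2)
  from CAdd.prems(2) obtain c1 c2 where c: "c = CAdd c1 c2"
    by (cases c) auto
  show ?case
  proof (cases a)
    case CNil
    then show ?thesis using c by simp
  next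
    case a: (CAdd a1 a2)
    show ?thesis using CAdd.prems CAdd.IH(1)[of a1 c1] CAdd.IH(2)[of a2 c2]
      unfolding a c by auto
  qed
qed

lemma cless_total: "cless a b \<or> a = b \<or> cless b a"
proof (induction a arbitrary: b)
  case CNil
  show ?case by (cases b) auto
next
  case (CAdd a1 a2)
  then show ?case by (cases b) auto
qed

lemma nf_CAddD: "nf (CAdd a b) \<Longrightarrow> nf a \<and> nf b"
  by (cases b) auto

lemma nf_csuc: "nf a \<Longrightarrow> nf (csuc a)"
proof (induction a)
  case (CAdd a b)
  then show ?case by (cases b) (auto simp: cless_CNil_left)
qed simp

lemma cless_csuc_iff: "cless a (csuc b) \<longleftrightarrow> a = b \<or> cless a b"
proof (induction b arbitrary: a)
  case CNil
  have "\<not> cless x CNil" for x by simp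
  then show ?case by (cases a) auto
next
  case (CAdd b1 b2)
  then show ?case by (cases a) auto
qed

definition nf_less :: "(cnf \<times> cnf) set" where
  "nf_less = {(a, b). nf a \<and> nf b \<and> cless a b}"

lemma nf_acc_aux:
  assumes "a \<in> Wellfounded.acc nf_less" and "b \<in> Wellfounded.acc nf_less"
    and "nf (CAdd a b)"
  shows "CAdd a b \<in> Wellfounded.acc nf_less"
  using assms
proof (induction a arbitrary: b rule: acc.induct)
  case (accI a)
  have below: "nf d \<Longrightarrow> (\<And>e f. d = CAdd e f \<Longrightarrow> cless e a) \<Longrightarrow> d \<in> Wellfounded.acc nf_less" for d
  proof (induction d)
    case CNil
    show ?case by (rule acc.accI) (simp add: nf_less_def)
  next
    case (CAdd e f)
    have e: "cless e a" using CAdd.prems(2) by blast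
    have nfs: "nf e" "nf f" "nf a"
      using nf_CAddD[OF CAdd.prems(1)] nf_CAddD[OF accI.prems(2)] by auto
    have "f \<in> Wellfounded.acc nf_less"
    proof (rule CAdd.IH(2)[OF nfs(2)])
      fix g k assume "f = CAdd g k"
      then have "g = e \<or> cless g e" using CAdd.prems(1) by simp
      then show "cless g a" using e cless_trans by blast
    qed
    moreover have "(e, a) \<in> nf_less" using e nfs by (simp add: nf_less_def)
    ultimately show ?case using accI.IH CAdd.prems(1) by blast
  qed
  show ?case using accI.prems
  proof (induction b rule: acc.induct)
    case inner: (accI b)
    show ?case
    proof (rule acc.accI)
      fix y assume y: "(y, CAdd a b) \<in> nf_less"
      show "y \<in> Wellfounded.acc nf_less"
      proof (cases y)
        case CNil
        then show ?thesis using below[of CNil] by simp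
      next
        case (CAdd c d)
        have nfy: "nf (CAdd c d)" using y CAdd by (simp add: nf_less_def)
        from y CAdd consider "cless c a" | "c = a" "cless d b"
          by (auto simp: nf_less_def)
        then show ?thesis
        proof cases
          case 1
          then show ?thesis using below[of y] nfy CAdd by auto
        next
          case 2
          have "(d, b) \<in> nf_less"
            using 2 nf_CAddD[OF nfy] nf_CAddD[OF inner.prems] by (simp add: nf_less_def)
          then show ?thesis using inner.IH nfy CAdd 2 by blast
        qed
      qed
    qed
  qed
qed

lemma nf_acc: "nf a \<Longrightarrow> a \<in> Wellfounded.acc nf_less"
proof (induction a)
  case CNil
  show ?case by (rule acc.accI) (simp add: nf_less_def)
next
  case (CAdd a b)
  then show ?case using nf_acc_aux nf_CAddD by blast
qed

lemma wf_nf_less: "wf nf_less"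
proof (rule acc_wfI, rule allI)
  fix a
  show "a \<in> Wellfounded.acc nf_less"
  proof (cases "nf a")
    case False
    show ?thesis by (rule acc.accI) (use False in \<open>simp add: nf_less_def\<close>)
  qed (rule nf_acc)
qed

typedef eps0 = "{a. nf a}"
  by (rule exI[of _ CNil]) simp

setup_lifting type_definition_eps0

instantiation eps0 :: wellorder
begin

lift_definition less_eps0 :: "eps0 \<Rightarrow> eps0 \<Rightarrow> bool" is cless .

lift_definition less_eq_eps0 :: "eps0 \<Rightarrow> eps0 \<Rightarrow> bool" is "\<lambda>a b. a = b \<or> cless a b" .

instance
proof
  fix x y z :: eps0
  show "x < y \<longleftrightarrow> x \<le> y \<and> \<not> y \<le> x"
    by transfer (metis cless_irrefl cless_trans)
  show "x \<le> x" by transfer simp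
  show "x \<le> y \<Longrightarrow> y \<le> z \<Longrightarrow> x \<le> z" by transfer (metis cless_trans)
  show "x \<le> y \<Longrightarrow> y \<le> x \<Longrightarrow> x = y" by transfer (metis cless_irrefl cless_trans)
  show "x \<le> y \<or> y \<le> x" by transfer (metis cless_total)
next
  fix P :: "eps0 \<Rightarrow> bool" and a
  assume step: "\<And>x. (\<And>y. y < x \<Longrightarrow> P y) \<Longrightarrow> P x"
  have "wf (inv_image nf_less Rep_eps0)" by (intro wf_inv_image wf_nf_less)
  then show "P a"
  proof (induction a rule: wf_induct_rule)
    case (less x)
    have "(y, x) \<in> inv_image nf_less Rep_eps0" if "y < x" for y
      using that Rep_eps0[of x] Rep_eps0[of y]
      by (simp add: less_eps0.rep_eq nf_less_def)
    then show ?case using step less by blast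
  qed
qed

end

instantiation eps0 :: zero
begin

lift_definition zero_eps0 :: eps0 is CNil by simp

instance ..

end

lift_definition osuc :: "eps0 \<Rightarrow> eps0" is csuc by (rule nf_csuc)

lift_definition opow :: "eps0 \<Rightarrow> eps0" is "\<lambda>a. CAdd a CNil" by simp

lemma osuc_le_iff: "osuc v \<le> w \<longleftrightarrow> v < w"
proof -
  have "w < osuc v \<longleftrightarrow> w \<le> v" by transfer (rule cless_csuc_iff)
  then show ?thesis by (meson not_le)
qed

lemma opow_less_iff: "opow v < opow w \<longleftrightarrow> v < w"
  by transfer simp

lemma opow_zero: "opow 0 = osuc 0"
  by transfer simp

abbreviation omega :: eps0 where
  "omega \<equiv> opow (osuc 0)"

datatype const_sym = Sym_h | Sym_0

datatype unary_sym = Sym_I | Sym_E | Sym_s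

datatype binary_sym = Sym_C | Sym_D | Sym_A eps0 | Sym_B eps0 | Sym_Par

datatype trm =
    Var string
  | Fun0 const_sym
  | Fun1 unary_sym trm
  | Fun2 binary_sym trm trm

abbreviation "th \<equiv> Fun0 Sym_h"
abbreviation "t0 \<equiv> Fun0 Sym_0"
abbreviation "tI \<equiv> Fun1 Sym_I"
abbreviation "tE \<equiv> Fun1 Sym_E"
abbreviation "ts \<equiv> Fun1 Sym_s"
abbreviation "tC \<equiv> Fun2 Sym_C"
abbreviation "tD \<equiv> Fun2 Sym_D"
abbreviation "tA v \<equiv> Fun2 (Sym_A v)"
abbreviation "tB v \<equiv> Fun2 (Sym_B v)"
abbreviation par :: "trm \<Rightarrow> trm \<Rightarrow> trm" (infixr "\<parallel>" 65)
  where "par \<equiv> Fun2 Sym_Par"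

fun subst :: "(string \<Rightarrow> trm) \<Rightarrow> trm \<Rightarrow> trm" where
  "subst \<sigma> (Var x) = \<sigma> x"
| "subst \<sigma> (Fun0 c) = Fun0 c"
| "subst \<sigma> (Fun1 f t) = Fun1 f (subst \<sigma> t)"
| "subst \<sigma> (Fun2 f t u) = Fun2 f (subst \<sigma> t) (subst \<sigma> u)"

datatype ctxt =
    Hole
  | Ctx1 unary_sym ctxt
  | Ctx2L binary_sym ctxt trm
  | Ctx2R binary_sym trm ctxt

fun fill :: "ctxt \<Rightarrow> trm \<Rightarrow> trm" where
  "fill Hole t = t"
| "fill (Ctx1 f K) t = Fun1 f (fill K t)"
| "fill (Ctx2L f K u) t = Fun2 f (fill K t) u"
| "fill (Ctx2R f u K) t = Fun2 f u (fill K t)"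

type_synonym trs = "(trm \<times> trm) set"

definition rstep :: "trs \<Rightarrow> (trm \<times> trm) set" where
  "rstep R = {(fill K (subst \<sigma> l), fill K (subst \<sigma> r)) | K \<sigma> l r. (l, r) \<in> R}"

inductive_set ac_eq :: "(trm \<times> trm) set" where
  comm: "(t \<parallel> u, u \<parallel> t) \<in> ac_eq"
| assoc: "((t \<parallel> u) \<parallel> w, t \<parallel> (u \<parallel> w)) \<in> ac_eq"
| refl: "(t, t) \<in> ac_eq"
| sym: "(t, u) \<in> ac_eq \<Longrightarrow> (u, t) \<in> ac_eq"
| trans: "(t, u) \<in> ac_eq \<Longrightarrow> (u, w) \<in> ac_eq \<Longrightarrow> (t, w) \<in> ac_eq"
| cong1: "(t, t') \<in> ac_eq \<Longrightarrow> (Fun1 f t, Fun1 f t') \<in> ac_eq"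
| cong2: "(t, t') \<in> ac_eq \<Longrightarrow> (u, u') \<in> ac_eq \<Longrightarrow> (Fun2 f t u, Fun2 f t' u') \<in> ac_eq"

definition rstep_ac :: "trs \<Rightarrow> (trm \<times> trm) set" where
  "rstep_ac R = ac_eq O rstep R O ac_eq"

text \<open>
  The converse is needed because \<open>wf\<close> has the smaller element on the left, whereas a rewrite step
  has the reduct on the right.
\<close>

definition ac_terminating :: "trs \<Rightarrow> bool" where
  "ac_terminating R \<longleftrightarrow> wf ((rstep_ac R)\<inverse>)"

definition H_lab :: trs where
  "H_lab =
    (let n = Var ''n''; x = Var ''x''; y = Var ''y'' in
      {(tA omega n (tI th), tA (osuc 0) (ts n) th)}
    \<union> {(tA (opow (osuc v)) n (tI (th \<parallel> x)), tA (opow v) (ts n) (tI x)) | v. True}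
    \<union> {(tA (opow v) n (tI x), tB (opow v) n (tD (ts n) (tI x))) | v. True}
    \<union> {(tC t0 x, tE x),
       (tC (ts n) x, x \<parallel> tC n x),
       (tI (tE x \<parallel> y), tE (tI (x \<parallel> y))),
       (tI (tE x), tE (tI x)),
       (tD n (tI (tI x)), tI (tD n (tI x))),
       (tD n (tI (tI x \<parallel> y)), tI (tD n (tI x) \<parallel> y)),
       (tD n (tI (tI (th \<parallel> x) \<parallel> y)), tI (tC n (tI x) \<parallel> y)),
       (tD n (tI (tI (th \<parallel> x))), tI (tC n (tI x))),
       (tD n (tI (tI th \<parallel> y)), tI (tC n th \<parallel> y)),
       (tD n (tI (tI th)), tI (tC n th))}
    \<union> {(tB (osuc v) n (tE x), tA v (ts n) x) | v. True})"

definition Dec :: trs where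
  "Dec =
    (let n = Var ''n''; x = Var ''x'' in
      {(tA v n x, tA w n x) | v w. v > w}
    \<union> {(tB v n x, tB w n x) | v w. v > w})"

end

theory Submission
  imports Defs "HOL-Library.Multiset" "HOL-Library.Product_Lexorder"
begin

text \<open>
  All rules decrease in a multiset path order whose precedence puts
  \<open>A v > B v > A w > D > C, I > E, s\<close> for \<open>v > w\<close> and \<open>\<parallel>\<close> at the bottom.
  As \<open>\<parallel>\<close> is minimal, it can be read as multiset union: a term denotes a finite multiset of trees
  whose arguments are again such multisets, so AC-equivalent terms have the same denotation.
  The path order on these trees is well-founded by Buchholz's argument: a tree whose
  arguments consist of accessible trees is accessible, by induction on the precedence and then on
  the argument multisets.
\<close>

datatype 'a tree = Node 'a "'a tree multiset" "'a tree multiset"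

text \<open>Transitivity is a rule so that the order needs no side conditions in the cases \<open>arg1\<close>, \<open>arg2\<close>.\<close>

inductive_set path_order :: "('a::wellorder tree \<times> 'a tree) set" where
  sub1: "s \<in># M \<Longrightarrow> (s, Node f M N) \<in> path_order"
| sub2: "s \<in># N \<Longrightarrow> (s, Node f M N) \<in> path_order"
| trans: "(s, t) \<in> path_order \<Longrightarrow> (t, u) \<in> path_order \<Longrightarrow> (s, u) \<in> path_order"
| prec: "g < f \<Longrightarrow> (\<And>s. s \<in># K \<Longrightarrow> (s, Node f M N) \<in> path_order)
    \<Longrightarrow> (\<And>s. s \<in># L \<Longrightarrow> (s, Node f M N) \<in> path_order)
    \<Longrightarrow> (Node g K L, Node f M N) \<in> path_order"
| arg1: "(K, M) \<in> mult path_order \<Longrightarrow> (Node f K N, Node f M N) \<in> path_order"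
| arg2: "(K, N) \<in> mult path_order \<Longrightarrow> (Node f M K, Node f M N) \<in> path_order"

lemma trans_path_order: "trans path_order"
  by (rule transI) (rule path_order.trans)

text \<open>Makes \<open>mult\<close> available as an induction measure before
  \<open>path_order\<close> is known to be well-founded: cut down to accessible upper elements, any
  relation is well-founded.\<close>

definition acc_restrict :: "('a \<times> 'a) set \<Rightarrow> ('a \<times> 'a) set" where
  "acc_restrict R = {(a, b) \<in> R. b \<in> Wellfounded.acc R}"

lemma wf_acc_restrict: "wf (acc_restrict R)"
proof (rule acc_wfI, rule allI)
  fix x
  have acc: "y \<in> Wellfounded.acc (acc_restrict R)" if "y \<in> Wellfounded.acc R" for y
    using that by (induction rule: acc.induct) (auto simp: acc_restrict_def intro: acc.accI)
  show "x \<in> Wellfounded.acc (acc_restrict R)"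
    by (rule acc.accI, rule acc) (auto simp: acc_restrict_def dest: acc_downward)
qed

lemma mult_acc_restrict:
  assumes "(K, M) \<in> mult R" and "trans R" and "\<And>s. s \<in># M \<Longrightarrow> s \<in> Wellfounded.acc R"
  shows "(K, M) \<in> mult (acc_restrict R)"
  using assms by (auto intro: mult_mono_strong simp: acc_restrict_def)

lemma mult_acc:
  assumes "(K, M) \<in> mult R" and "trans R" and "\<And>s. s \<in># M \<Longrightarrow> s \<in> Wellfounded.acc R"
    and "t \<in># K"
  shows "t \<in> Wellfounded.acc R"
  using mult_implies_one_step[OF assms(2,1)] assms(3,4) by (auto; meson acc_downward)

lemma Node_acc:
  fixes M N :: "'a::wellorder tree multiset"
  assumes "\<forall>s\<in>#M + N. s \<in> Wellfounded.acc path_order"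
  shows "Node f M N \<in> Wellfounded.acc path_order"
proof -
  let ?A = "Wellfounded.acc path_order"
  let ?m = "mult (acc_restrict path_order) :: ('a tree multiset \<times> _) set"
  have "wf ({(g, f :: 'a). g < f} <*lex*> ?m <*lex*> ?m)"
    by (intro wf_lex_prod wf_mult wf_acc_restrict wf)
  then have *: "\<forall>s\<in>#fst (snd p) + snd (snd p). s \<in> ?A
      \<Longrightarrow> Node (fst p) (fst (snd p)) (snd (snd p)) \<in> ?A" for p :: "'a \<times> _"
  proof (induction p rule: wf_induct_rule)
    case (less p)
    obtain f M N where p: "p = (f, M, N)" by (cases p) auto
    have args: "s \<in> ?A" if "s \<in># M \<or> s \<in># N" for s using less.prems p that by auto
    have IH: "Node g K L \<in> ?A"
      if "g < f \<or> g = f \<and> ((K, M) \<in> ?m \<or> K = M \<and> (L, N) \<in> ?m)"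
        and "\<And>s. s \<in># K \<Longrightarrow> s \<in> ?A" "\<And>s. s \<in># L \<Longrightarrow> s \<in> ?A" for g K L
      using less.IH[of "(g, K, L)"] that p by auto
    \<comment> \<open>Induction on the derivation copes with \<open>trans\<close>: the middle tree
      is accessible by hypothesis, and accessibility passes downward.\<close>
    have "t \<in> ?A" if "(t, u) \<in> path_order" "u = Node f M N" for t u
      using that
    proof (induction rule: path_order.induct)
      case (trans s t u)
      then show ?case by (meson acc_downward)
    next
      case (arg1 K M' f' N')
      \<comment> \<open>The induction rule supplies \<open>mult\<close> of the order conjoined with
        the induction predicate; monotonicity drops the predicate.\<close>
      then have K: "(K, M) \<in> mult path_order"
        using mono_mult[THEN subsetD, rotated] by fastforce
      then show ?case
        using arg1 mult_acc_restrict[OF K] mult_acc[OF K] trans_path_order args by (auto intro!: IH)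
    next
      case (arg2 K N' f' M')
      then have K: "(K, N) \<in> mult path_order"
        using mono_mult[THEN subsetD, rotated] by fastforce
      then show ?case
        using arg2 mult_acc_restrict[OF K] mult_acc[OF K] trans_path_order args by (auto intro!: IH)
    qed (auto intro: args IH)
    then show ?case using p by (auto intro: acc.accI)
  qed
  from *[of "(f, M, N)"] show ?thesis using assms by simp
qed

lemma wf_path_order: "wf path_order"
proof (rule acc_wfI, rule allI)
  show "t \<in> Wellfounded.acc path_order" for t :: "'a::wellorder tree"
    by (induction t) (auto intro!: Node_acc)
qed

lemma irrefl_path_order: "irrefl_on A path_order"
  by (auto simp: irrefl_on_def wf_path_order)

text \<open>Lexicographic: symbol group, then label, then a bit that puts \<open>Sym_A v\<close>
  above \<open>Sym_B v\<close>.\<close>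

type_synonym rank = "nat \<times> eps0 \<times> nat"

fun rank1 :: "unary_sym \<Rightarrow> rank" where
  "rank1 Sym_I = (1, 0, 0)"
| "rank1 _ = (0, 0, 0)"

fun rank2 :: "binary_sym \<Rightarrow> rank" where
  "rank2 Sym_C = (1, 0, 0)"
| "rank2 Sym_D = (2, 0, 0)"
| "rank2 (Sym_A v) = (3, v, 1)"
| "rank2 (Sym_B v) = (3, v, 0)"
| "rank2 Sym_Par = (0, 0, 0)"

fun denot :: "trm \<Rightarrow> rank tree multiset" where
  "denot (Var x) = {#Node (0, 0, 0) {#} {#}#}"
| "denot (Fun0 c) = {#Node (0, 0, 0) {#} {#}#}"
| "denot (Fun1 f t) = {#Node (rank1 f) (denot t) {#}#}"
| "denot (Fun2 f t u) =
    (if f = Sym_Par then denot t + denot u else {#Node (rank2 f) (denot t) (denot u)#})"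

lemma denot_ac_eq: "(t, u) \<in> ac_eq \<Longrightarrow> denot t = denot u"
  by (induction rule: ac_eq.induct) (auto simp: ac_simps)

lemma mult_singletonI: "(\<forall>s\<in>#K. (s, t) \<in> R) \<Longrightarrow> (K, {#t#}) \<in> mult R"
  using one_step_implies_mult[of "{#t#}" K R "{#}"] by simp

text \<open>Below \<open>Sym_Par\<close> the common summand cancels, which uses irreflexivity; below
  any other symbol one argument of a single node decreases.\<close>

lemma denot_fill:
  "(denot t, denot u) \<in> mult path_order \<Longrightarrow> (denot (fill K t), denot (fill K u)) \<in> mult path_order"
proof (induction K)
  case (Ctx2L f K w)
  then show ?case
    by (auto intro!: mult_singletonI path_order.arg1
      simp: mult_cancel[OF trans_path_order] irrefl_path_order)
next
  case (Ctx2R f w K)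
  then show ?case
    by (auto intro!: mult_singletonI path_order.arg2
      simp: mult_cancel[OF trans_path_order] irrefl_path_order add.commute[of "denot w"])
qed (auto intro!: mult_singletonI path_order.arg1)

text \<open>The disjunctive premise lets conditional rewriting descend through nested arguments
  without guessing the middle tree of \<open>trans\<close>.\<close>

lemma path_order_sub:
  "s \<in># M \<or> s \<in># N \<or> (\<exists>t\<in>#M. (s, t) \<in> path_order) \<or> (\<exists>t\<in>#N. (s, t) \<in> path_order)
    \<Longrightarrow> (s, Node f M N) \<in> path_order"
  by (meson path_order.intros)

lemma path_order_prec:
  "g < f \<Longrightarrow> \<forall>s\<in>#K + L. (s, Node f M N) \<in> path_order \<Longrightarrow> (Node g K L, Node f M N) \<in> path_order"
  by (rule path_order.prec) auto

lemma mult_add_msetI: "(M, add_mset t M) \<in> mult R"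
  using one_step_implies_mult[of "{#t#}" "{#}" R M] by simp

lemma mult_union_add_msetI:
  "(\<forall>s\<in>#K. (s, t) \<in> R) \<Longrightarrow> (K + M, add_mset t M) \<in> mult R"
  using one_step_implies_mult[of "{#t#}" K R M] by (simp add: ac_simps)

lemma less_osuc: "v < osuc v"
  using osuc_le_iff by auto

lemma osuc_0_less_omega: "osuc 0 < omega"
  using opow_less_iff[of 0 "osuc 0"] less_osuc[of 0] by (simp add: opow_zero)

text \<open>The root decreases by \<open>prec\<close>, except that \<open>tC (ts n) x\<close>
  dominates \<open>x\<close> as an argument and \<open>tC n x\<close> by \<open>arg1\<close>. Calls
  of \<open>tI\<close> and \<open>tD\<close> moved below a new root have smaller arguments.\<close>

lemma denot_rule:
  assumes "(l, r) \<in> H_lab \<union> Dec"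
  shows "(denot (subst \<sigma> r), denot (subst \<sigma> l)) \<in> mult path_order"
  using assms unfolding H_lab_def Dec_def Let_def
  by (simp only: Un_iff insert_iff empty_iff mem_Collect_eq prod.inject ex_simps simp_thms)
    (elim disjE exE conjE; simp add: ball_Un less_osuc opow_less_iff osuc_0_less_omega
      path_order_sub path_order_prec path_order.arg1 path_order.arg2
      mult_singletonI mult_add_msetI mult_union_add_msetI)

theorem theorem5p8: "ac_terminating (H_lab \<union> Dec)"
proof -
  have "(t, s) \<in> inv_image (mult path_order) denot"
    if "(s, t) \<in> rstep_ac (H_lab \<union> Dec)" for s t
  proof -
    from that obtain K \<sigma> l r where "(l, r) \<in> H_lab \<union> Dec"
      and "(s, fill K (subst \<sigma> l)) \<in> ac_eq" "(fill K (subst \<sigma> r), t) \<in> ac_eq"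
      unfolding rstep_ac_def rstep_def by blast
    \<comment> \<open>\<open>denot\<close> is constant along both AC parts, so only the rewrite step
      counts.\<close>
    then show ?thesis
      using denot_fill[OF denot_rule] by (metis denot_ac_eq in_inv_image)
  qed
  then have "(rstep_ac (H_lab \<union> Dec))\<inverse> \<subseteq> inv_image (mult path_order) denot"
    by auto
  then show ?thesis
    unfolding ac_terminating_def by (meson wf_inv_image wf_mult wf_path_order wf_subset)
qed

end
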